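(* Let $a,b,m,n$ be nonnegative integers with $a\geq m+2$ and $b\geq n+2$. Then $$\zeta(a;m)\zeta(b;n)=\sum_{i=0}^{m}\sum_{k=n}^{m+n-i}\binom{k}{n}\binom{n+1}{i+k-m+1}\zeta(b,a;k,i)+\sum_{i=0}^{n}\sum_{k=m}^{m+n-i}\binom{k}{m}\binom{m+1}{i+k-n+1}\zeta(a,b;k,i)+\sum_{k=n}^{m+n}\binom{k}{n}\binom{n}{k-m}\zeta(a+b;k).$$
   Context: Binomial convention: $\binom{p}{q}=0$ if $p<q$ or $q<0$. For positive integers $s_1,\ldots,s_k$ and nonnegative integers $I=(i_1,\ldots,i_k)$, the left weak composition multiple zeta value is $$\zeta(s_1,\ldots,s_k;I)=\zeta(s_1,\ldots,s_k;i_1,\ldots,i_k)=\sum_{1\leq n_1<n_2<\cdots<n_k}\binom{n_1-1}{i_1}\binom{n_2-n_1-1}{i_2}\cdots\binom{n_k-n_{k-1}-1}{i_k}\frac{1}{n_1^{s_1}\cdots n_k^{s_k}},$$ which converges e.g. when $s_p\geq i_p+2$ for all $p$. *)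

theory Defs
  imports "HOL-Analysis.Analysis"
begin

text \<open>Binomial coefficient with integer arguments that vanishes for a negative lower argument.
  The truncated subtraction on \<^typ>\<open>nat\<close> would turn such a lower argument into a
  nonnegative one.\<close>

definition binom :: "int \<Rightarrow> int \<Rightarrow> nat" where
  "binom p q = (if p < q \<or> q < 0 then 0 else nat p choose nat q)"

text \<open>The tuples \<open>1 \<le> n\<^sub>1 < \<dots> < n\<^sub>k\<close>, as lists.\<close>

definition mzv_index :: "nat \<Rightarrow> nat list set" where
  "mzv_index k = {ns. length ns = k \<and> sorted_wrt (<) ns \<and> (\<forall>x\<in>set ns. 1 \<le> x)}"

text \<open>With the convention \<open>n\<^sub>0 = 0\<close>, supplied by \<open>0 # ns\<close>, the \<open>j\<close>-th binomial coefficient has upper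
  argument \<open>n\<^sub>j - n\<^sub>j\<^sub>-\<^sub>1 - 1\<close> also for the first entry. List positions count from 0, so \<open>ns ! j\<close> and
  \<open>(0 # ns) ! j\<close> are an entry and its predecessor.\<close>

definition lwc_mzv_term :: "nat list \<Rightarrow> nat list \<Rightarrow> nat list \<Rightarrow> real" where
  "lwc_mzv_term s I ns =
     (\<Prod>j<length s. real (binom (int (ns ! j) - int ((0 # ns) ! j) - 1) (int (I ! j))) /
                   real (ns ! j) ^ (s ! j))"

text \<open>Meaningful for \<open>length I = length s\<close>. All terms are nonnegative, so summing over the
  unordered index set gives the value of the multiple series.\<close>

definition lwc_mzv :: "nat list \<Rightarrow> nat list \<Rightarrow> real" where
  "lwc_mzv s I = (\<Sum>\<^sub>\<infinity>ns\<in>mzv_index (length s). lwc_mzv_term s I ns)"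

text \<open>Convergence in depths one and two. \<^const>\<open>infsum\<close> of a divergent family is 0; at arguments
  covered by these lemmas the value of \<^const>\<open>lwc_mzv\<close> is a genuine sum. In depth two the condition is
  weaker than \<open>s\<^sub>p \<ge> i\<^sub>p + 2\<close> for both \<open>p\<close>, because \<open>\<zeta>(b,a;k,i)\<close> is also needed for \<open>k > b - 2\<close>.\<close>

lemma binom_le_power:
  assumes "p < int x"
  shows "real (binom p (int i)) \<le> real x ^ i"
proof (cases "p < int i")
  case False
  hence "binom p (int i) = nat p choose i"
    by (simp add: binom_def)
  also have "\<dots> \<le> nat p ^ i"
    using binomial_le_pow[of i "nat p"] False by linarith
  also have "\<dots> \<le> x ^ i"
    using assms by (intro power_mono) auto
  finally have "real (binom p (int i)) \<le> real (x ^ i)"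
    by (simp only: of_nat_le_iff)
  thus ?thesis by simp
qed (simp add: binom_def)

lemma inverse_square_summable_on: "(\<lambda>x. 1 / real x ^ 2) summable_on A"
proof -
  have "(\<lambda>x. 1 / real x ^ 2) summable_on UNIV"
    using inverse_power_summable[of 2, where ?'a = real]
    by (subst summable_on_UNIV_nonneg_real_iff) (auto simp: inverse_eq_divide)
  thus ?thesis
    by (rule summable_on_subset_banach) simp
qed

lemma lwc_mzv_term_summable_1:
  assumes "i + 2 \<le> s"
  shows "lwc_mzv_term [s] [i] summable_on mzv_index 1"
proof -
  have eq: "mzv_index 1 = (\<lambda>x. [x]) ` {1..}"
    by (auto simp: mzv_index_def length_Suc_conv)
  have "(\<lambda>x. lwc_mzv_term [s] [i] [x]) summable_on {1..}"
  proof (rule summable_on_comparison_test[OF inverse_square_summable_on])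
    fix x :: nat assume "x \<in> {1..}"
    hence x: "1 \<le> x" by simp
    have "real (binom (int x - 1) (int i)) \<le> real x ^ i"
      by (rule binom_le_power) simp
    hence "real (binom (int x - 1) (int i)) * real x ^ 2 \<le> real x ^ i * real x ^ 2"
      by (rule mult_right_mono) simp
    also have "\<dots> \<le> real x ^ s"
      using x assms by (subst power_add [symmetric]) (intro power_increasing, auto)
    finally show "lwc_mzv_term [s] [i] [x] \<le> 1 / real x ^ 2"
      using x by (simp add: lwc_mzv_term_def field_simps)
  qed (simp add: lwc_mzv_term_def)
  thus ?thesis
    unfolding eq by (subst summable_on_reindex) (auto simp: o_def inj_on_def)
qed

lemma lwc_mzv_term_summable_2:
  assumes "i\<^sub>2 + 2 \<le> s\<^sub>2" and "i\<^sub>1 + i\<^sub>2 + 4 \<le> s\<^sub>1 + s\<^sub>2"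
  shows "lwc_mzv_term [s\<^sub>1, s\<^sub>2] [i\<^sub>1, i\<^sub>2] summable_on mzv_index 2"
proof -
  let ?P = "{(x, y). 1 \<le> x \<and> x < (y::nat)}"
  have eq: "mzv_index 2 = (\<lambda>(x, y). [x, y]) ` ?P"
    by (auto simp: mzv_index_def length_Suc_conv numeral_2_eq_2 image_iff)
  have "(\<lambda>(x, y). 1 / real x ^ 2 * (1 / real y ^ 2)) summable_on UNIV \<times> UNIV"
  proof (rule summable_on_SigmaI[where g = "\<lambda>x. 1 / real x ^ 2 * (\<Sum>\<^sub>\<infinity>y. 1 / real y ^ 2)"])
    show "((\<lambda>y. case (x, y) of (x, y) \<Rightarrow> 1 / real x ^ 2 * (1 / real y ^ 2)) has_sum
        1 / real x ^ 2 * (\<Sum>\<^sub>\<infinity>y. 1 / real y ^ 2)) UNIV" for x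
      unfolding prod.case
      by (intro has_sum_cmult_right has_sum_infsum inverse_square_summable_on)
    show "(\<lambda>x. 1 / real x ^ 2 * (\<Sum>\<^sub>\<infinity>y. 1 / real y ^ 2)) summable_on UNIV"
      by (intro summable_on_cmult_left inverse_square_summable_on)
  qed auto
  hence *: "(\<lambda>(x, y). 1 / real x ^ 2 * (1 / real y ^ 2)) summable_on ?P"
    by (rule summable_on_subset_banach) simp
  have "(\<lambda>(x, y). lwc_mzv_term [s\<^sub>1, s\<^sub>2] [i\<^sub>1, i\<^sub>2] [x, y]) summable_on ?P"
  proof (rule summable_on_comparison_test[OF *], goal_cases)
    case (1 z)
    obtain x y where z: "z = (x, y)" and x: "1 \<le> x" and xy: "x < y"
      using 1 by auto
    let ?A = "real (binom (int x - 1) (int i\<^sub>1))"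
    let ?B = "real (binom (int y - int x - 1) (int i\<^sub>2))"
    have A: "?A \<le> real x ^ i\<^sub>1" by (rule binom_le_power) simp
    have B: "?B \<le> real y ^ i\<^sub>2" by (rule binom_le_power) simp
    have "(?A * real x ^ 2) * (?B * real y ^ 2)
          \<le> (real x ^ i\<^sub>1 * real x ^ 2) * (real y ^ i\<^sub>2 * real y ^ 2)"
      using A B by (intro mult_mono) auto
    also have "\<dots> = real x ^ (i\<^sub>1 + 2) * real y ^ (i\<^sub>2 + 2)"
      by (simp only: power_add)
    also have "\<dots> \<le> real x ^ s\<^sub>1 * real y ^ s\<^sub>2"
    proof (cases "i\<^sub>1 + 2 \<le> s\<^sub>1")
      case True
      thus ?thesis using x xy assms by (intro mult_mono power_increasing) auto
    next
      case False
      hence "real x ^ (i\<^sub>1 + 2) = real x ^ s\<^sub>1 * real x ^ (i\<^sub>1 + 2 - s\<^sub>1)"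
        by (subst power_add [symmetric]) simp
      also have "\<dots> \<le> real x ^ s\<^sub>1 * real y ^ (i\<^sub>1 + 2 - s\<^sub>1)"
        using xy by (intro mult_left_mono power_mono) auto
      finally have "real x ^ (i\<^sub>1 + 2) * real y ^ (i\<^sub>2 + 2)
          \<le> real x ^ s\<^sub>1 * real y ^ (i\<^sub>1 + 2 - s\<^sub>1) * real y ^ (i\<^sub>2 + 2)"
        by (rule mult_right_mono) simp
      also have "\<dots> = real x ^ s\<^sub>1 * real y ^ (i\<^sub>1 + 2 - s\<^sub>1 + (i\<^sub>2 + 2))"
        by (simp only: power_add mult.assoc)
      also have "\<dots> \<le> real x ^ s\<^sub>1 * real y ^ s\<^sub>2"
        using x xy assms False by (intro mult_left_mono power_increasing) auto
      finally show ?thesis .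
    qed
    finally have "(?A * real x ^ 2) * (?B * real y ^ 2) \<le> real x ^ s\<^sub>1 * real y ^ s\<^sub>2" .
    thus ?case
      using x xy by (simp add: z lwc_mzv_term_def numeral_2_eq_2 lessThan_Suc divide_simps mult_ac)
  qed (auto simp: lwc_mzv_term_def intro!: prod_nonneg)
  thus ?thesis
    unfolding eq by (subst summable_on_reindex) (auto simp: o_def inj_on_def case_prod_unfold)
qed

end

theory Submission
  imports Defs
begin

text \<open>Split the double series for \<open>\<zeta>(a;m) \<zeta>(b;n)\<close> according to \<open>x < y\<close>, \<open>x > y\<close> and \<open>x = y\<close>. For
  \<open>x < y\<close>, Vandermonde's convolution for \<open>y - 1 = (y - x - 1) + x\<close> expands \<open>binom (y - 1) m\<close> into
  products of \<open>binom (y - x - 1) i\<close> and \<open>binom x (m - i)\<close>; the product of the latter with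
  \<open>binom (x - 1) n\<close> is in turn a combination of the \<open>binom (x - 1) k\<close>. Collecting terms gives the
  series \<open>\<zeta>(b,a;k,i)\<close>. On the diagonal only the second expansion is needed.\<close>

lemma binom_of_nat [simp]: "binom (int p) (int q) = p choose q"
  by (simp add: binom_def)

text \<open>Symmetry of binomial coefficients; for \<open>r > p\<close> the lower argument on the
  left is negative and both sides vanish. This translates the integer coefficients of the theorem
  into ordinary ones.\<close>

lemma binom_reflect: "binom (int p) (int p - int r) = p choose r"
proof (cases "r \<le> p")
  case True
  hence "binom (int p) (int p - int r) = binom (int p) (int (p - r))"
    by simp
  thus ?thesis
    using binomial_symmetric[OF True] by (simp only: binom_of_nat)
qed (simp add: binom_def)

lemma binom_shifted_1: "1 \<le> x \<Longrightarrow> binom (int x - 1) (int i) = (x - 1) choose i"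
  using binom_of_nat[of "x - 1" i] by (simp add: of_nat_diff)

lemma binom_shifted_2: "x < y \<Longrightarrow> binom (int y - int x - 1) (int i) = (y - x - 1) choose i"
  using binom_of_nat[of "y - x - 1" i] by (simp add: of_nat_diff algebra_simps)

text \<open>Since \<open>binom Y k * binom k n = binom Y n * binom (Y - n) (k - n)\<close>, this is Vandermonde's
  convolution for \<open>Y + c = (Y - n) + (n + c)\<close>.\<close>

lemma choose_times_choose:
  "(Y choose n) * ((Y + c) choose j) =
     (\<Sum>k=n..n+j. (k choose n) * ((n + c) choose (n + j - k)) * (Y choose k))"
proof (cases "n \<le> Y")
  case True
  have "(\<Sum>k=n..n+j. (k choose n) * ((n + c) choose (n + j - k)) * (Y choose k)) =
        (\<Sum>t\<le>j. (Y choose n) * (((Y - n) choose t) * ((n + c) choose (j - t))))"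
  proof (rule sum.reindex_bij_witness[of _ "\<lambda>t. n + t" "\<lambda>k. k - n"])
    fix k assume "k \<in> {n..n+j}"
    \<comment> \<open>If \<open>k > Y\<close>, then also \<open>k - n > Y - n\<close> because
      \<open>n \<le> Y\<close>, so both sides are 0.\<close>
    moreover from this have "(Y choose k) * (k choose n) = (Y choose n) * ((Y - n) choose (k - n))"
      by (cases "k \<le> Y") (auto simp: choose_mult binomial_eq_0)
    ultimately show "(Y choose n) * (((Y - n) choose (k - n)) * ((n + c) choose (j - (k - n)))) =
        (k choose n) * ((n + c) choose (n + j - k)) * (Y choose k)"
      by (simp add: mult_ac add.commute)
  qed auto
  also have "\<dots> = (Y choose n) * ((Y - n + (n + c)) choose j)"
    by (simp only: sum_distrib_left[symmetric] vandermonde)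
  finally show ?thesis
    using True by simp
qed (auto simp: binomial_eq_0)

text \<open>After Vandermonde's convolution, the inner sum over \<open>k\<close> is
  \<open>choose_times_choose\<close> with \<open>Y = x - 1\<close>, \<open>c = 1\<close> and
  \<open>j = m - i\<close>. The shift \<open>c = 1\<close> turns \<open>x\<close> into
  \<open>Y + c\<close> and produces the upper argument \<open>n + 1\<close>.\<close>

lemma choose_product_below_diagonal:
  assumes "1 \<le> x" "x < y"
  shows "((x - 1) choose n) * ((y - 1) choose m) =
    (\<Sum>i=0..m. \<Sum>k=n..m+n-i. (k choose n) * binom (int n + 1) (int i + int k - int m + 1) *
       (((x - 1) choose k) * ((y - x - 1) choose i)))"
proof -
  have inner: "(\<Sum>k=n..m+n-i. (k choose n) * binom (int n + 1) (int i + int k - int m + 1) *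
      (((x - 1) choose k) * ((y - x - 1) choose i))) =
    ((x - 1) choose n) * (((y - x - 1) choose i) * (x choose (m - i)))" if "i \<le> m" for i
  proof -
    have "(\<Sum>k=n..m+n-i. (k choose n) * binom (int n + 1) (int i + int k - int m + 1) *
        (((x - 1) choose k) * ((y - x - 1) choose i))) =
      (\<Sum>k=n..n+(m-i). (k choose n) * ((n + 1) choose (n + (m - i) - k)) * ((x - 1) choose k))
        * ((y - x - 1) choose i)"
      unfolding sum_distrib_right
    proof (rule sum.cong)
      fix k assume k: "k \<in> {n..n+(m-i)}"
      have "binom (int (n + 1)) (int (n + 1) - int (n + (m - i) - k)) =
          (n + 1) choose (n + (m - i) - k)"
        by (rule binom_reflect)
      \<comment> \<open>The natural subtraction does not truncate, since
        \<open>k \<le> n + (m - i)\<close>.\<close>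
      moreover have "int (n + 1) - int (n + (m - i) - k) = int i + int k - int m + 1"
        using k that by (cases "i + k \<le> n + m") (auto simp: of_nat_diff)
      ultimately have "binom (int n + 1) (int i + int k - int m + 1) =
          (n + 1) choose (n + (m - i) - k)"
        by (simp add: add.commute)
      thus "(k choose n) * binom (int n + 1) (int i + int k - int m + 1) *
          (((x - 1) choose k) * ((y - x - 1) choose i)) =
          (k choose n) * ((n + 1) choose (n + (m - i) - k)) * ((x - 1) choose k)
            * ((y - x - 1) choose i)"
        by simp
    qed (use that in auto)
    also have "\<dots> = ((x - 1) choose n) * ((x - 1 + 1) choose (m - i)) * ((y - x - 1) choose i)"
      by (simp only: choose_times_choose)
    finally show ?thesis
      using assms by (simp add: mult_ac)
  qed
  have "(y - 1) choose m = (\<Sum>i\<le>m. ((y - x - 1) choose i) * (x choose (m - i)))"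
    using assms by (subst vandermonde) simp
  thus ?thesis
    by (simp only: atMost_atLeast0 sum_distrib_left) (intro sum.cong inner[symmetric], auto)
qed

text \<open>On the diagonal both upper arguments agree, so \<open>choose_times_choose\<close>
  applies with \<open>c = 0\<close>.\<close>

lemma choose_product_diagonal:
  "(Y choose m) * (Y choose n) =
    (\<Sum>k=n..m+n. (k choose n) * binom (int n) (int k - int m) * (Y choose k))"
proof -
  have "binom (int n) (int k - int m) = n choose (n + m - k)" if "k \<le> m + n" for k
    using binom_reflect[of n "n + m - k"] that by (simp add: of_nat_diff)
  thus ?thesis
    using choose_times_choose[of Y n 0 m] by (simp add: mult.commute add.commute)
qed

lemma has_sum_finite_sum:
  fixes f :: "'i \<Rightarrow> 'a \<Rightarrow> 'b :: topological_comm_monoid_add"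
  assumes "\<And>i. i \<in> I \<Longrightarrow> (f i has_sum s i) A"
  shows "((\<lambda>x. \<Sum>i\<in>I. f i x) has_sum (\<Sum>i\<in>I. s i)) A"
  using assms by (induction I rule: infinite_finite_induct) (auto intro: has_sum_add)

lemma lwc_mzv_has_sum_1:
  assumes "i + 2 \<le> s"
  shows "((\<lambda>x. real ((x - 1) choose i) / real x ^ s) has_sum lwc_mzv [s] [i]) {1..}"
proof -
  have eq: "mzv_index 1 = (\<lambda>x. [x]) ` {1..}"
    by (auto simp: mzv_index_def length_Suc_conv)
  have "(lwc_mzv_term [s] [i] has_sum lwc_mzv [s] [i]) (mzv_index 1)"
    using lwc_mzv_term_summable_1[OF assms] by (simp add: lwc_mzv_def has_sum_infsum)
  hence "((\<lambda>x. lwc_mzv_term [s] [i] [x]) has_sum lwc_mzv [s] [i]) {1..}"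
    unfolding eq by (subst (asm) has_sum_reindex) (auto simp: o_def inj_on_def)
  thus ?thesis
    by (rule iffD1[OF has_sum_cong, rotated])
       (simp add: lwc_mzv_term_def binom_shifted_1)
qed

lemma lwc_mzv_has_sum_2:
  assumes "i\<^sub>2 + 2 \<le> s\<^sub>2" and "i\<^sub>1 + i\<^sub>2 + 4 \<le> s\<^sub>1 + s\<^sub>2"
  shows "((\<lambda>(x, y). real (((x - 1) choose i\<^sub>1) * ((y - x - 1) choose i\<^sub>2)) / (real x ^ s\<^sub>1 * real y ^ s\<^sub>2))
    has_sum lwc_mzv [s\<^sub>1, s\<^sub>2] [i\<^sub>1, i\<^sub>2]) {(x, y). 1 \<le> x \<and> x < y}"
proof -
  let ?P = "{(x, y). 1 \<le> x \<and> x < (y::nat)}"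
  have eq: "mzv_index 2 = (\<lambda>(x, y). [x, y]) ` ?P"
    by (auto simp: mzv_index_def length_Suc_conv numeral_2_eq_2 image_iff)
  have "(lwc_mzv_term [s\<^sub>1, s\<^sub>2] [i\<^sub>1, i\<^sub>2] has_sum lwc_mzv [s\<^sub>1, s\<^sub>2] [i\<^sub>1, i\<^sub>2]) (mzv_index 2)"
    using lwc_mzv_term_summable_2[OF assms]
    by (simp add: lwc_mzv_def has_sum_infsum numeral_2_eq_2)
  hence "((\<lambda>(x, y). lwc_mzv_term [s\<^sub>1, s\<^sub>2] [i\<^sub>1, i\<^sub>2] [x, y]) has_sum lwc_mzv [s\<^sub>1, s\<^sub>2] [i\<^sub>1, i\<^sub>2]) ?P"
    unfolding eq
    by (subst (asm) has_sum_reindex) (auto simp: o_def inj_on_def case_prod_unfold)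
  thus ?thesis
    by (rule iffD1[OF has_sum_cong, rotated])
       (auto simp: lwc_mzv_term_def binom_shifted_1 binom_shifted_2 lessThan_Suc mult_ac)
qed

lemma has_sum_below_diagonal:
  fixes a b m n :: nat
  assumes "a \<ge> m + 2" and "b \<ge> n + 2"
  shows "((\<lambda>(x, y). (real ((x - 1) choose n) / real x ^ b) * (real ((y - 1) choose m) / real y ^ a))
    has_sum (\<Sum>i=0..m. \<Sum>k=n..m+n-i.
      real (binom (int k) (int n)) * real (binom (int n + 1) (int i + int k - int m + 1)) *
      lwc_mzv [b, a] [k, i])) {(x, y). 1 \<le> x \<and> x < y}"
proof -
  let ?c = "\<lambda>i k. real (k choose n) * real (binom (int n + 1) (int i + int k - int m + 1))"
  let ?T = "\<lambda>k i (x, y). real (((x - 1) choose k) * ((y - x - 1) choose i)) / (real x ^ b * real y ^ a)"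
  have "((\<lambda>z. \<Sum>i=0..m. \<Sum>k=n..m+n-i. ?c i k * ?T k i z) has_sum
      (\<Sum>i=0..m. \<Sum>k=n..m+n-i. ?c i k * lwc_mzv [b, a] [k, i])) {(x, y). 1 \<le> x \<and> x < y}"
  proof (intro has_sum_finite_sum has_sum_cmult_right lwc_mzv_has_sum_2)
    fix i k assume "i \<in> {0..m}" "k \<in> {n..m+n-i}"
    \<comment> \<open>Here \<open>k\<close> may exceed \<open>b - 2\<close>, but
      \<open>k + i \<le> m + n \<le> a + b - 4\<close> still bounds the total.\<close>
    thus "i + 2 \<le> a" "k + i + 4 \<le> b + a"
      using assms by auto
  qed
  moreover have "(\<Sum>i=0..m. \<Sum>k=n..m+n-i. ?c i k * ?T k i (x, y)) =
      real ((x - 1) choose n) / real x ^ b * (real ((y - 1) choose m) / real y ^ a)"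
    if "1 \<le> x" "x < y" for x y
  proof -
    have "(\<Sum>i=0..m. \<Sum>k=n..m+n-i. ?c i k * ?T k i (x, y)) =
      real (\<Sum>i=0..m. \<Sum>k=n..m+n-i. (k choose n) * binom (int n + 1) (int i + int k - int m + 1) *
       (((x - 1) choose k) * ((y - x - 1) choose i))) / (real x ^ b * real y ^ a)"
      by (simp add: sum_divide_distrib)
    also have "\<dots> = real (((x - 1) choose n) * ((y - 1) choose m)) / (real x ^ b * real y ^ a)"
      by (simp only: choose_product_below_diagonal[OF that])
    finally show ?thesis by simp
  qed
  ultimately show ?thesis
    unfolding binom_of_nat
    by (elim iffD1[OF has_sum_cong, rotated]) (auto simp del: of_nat_mult)
qed

theorem theorem5p5:
  fixes a b m n :: nat
  assumes "a \<ge> m + 2" and "b \<ge> n + 2"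
  shows "lwc_mzv [a] [m] * lwc_mzv [b] [n] =
      (\<Sum>i=0..m. \<Sum>k=n..m+n-i.
         real (binom (int k) (int n)) * real (binom (int n + 1) (int i + int k - int m + 1)) *
         lwc_mzv [b, a] [k, i])
    + (\<Sum>i=0..n. \<Sum>k=m..m+n-i.
         real (binom (int k) (int m)) * real (binom (int m + 1) (int i + int k - int n + 1)) *
         lwc_mzv [a, b] [k, i])
    + (\<Sum>k=n..m+n.
         real (binom (int k) (int n)) * real (binom (int n) (int k - int m)) *
         lwc_mzv [a + b] [k])"
  (is "_ = ?S1 + ?S2 + ?S3")
proof -
  define f where "f x = real ((x - 1) choose m) / real x ^ a" for x
  define g where "g x = real ((x - 1) choose n) / real x ^ b" for x
  let ?h = "\<lambda>(x, y). f x * g y"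
  let ?P = "{(x, y). 1 \<le> x \<and> x < (y::nat)}"
  have f: "(f has_sum lwc_mzv [a] [m]) {1..}" and g: "(g has_sum lwc_mzv [b] [n]) {1..}"
    unfolding f_def g_def using assms by (intro lwc_mzv_has_sum_1; simp)+

  have "((\<lambda>(x, y). g x * f y) has_sum ?S1) ?P"
    unfolding f_def g_def by (rule has_sum_below_diagonal[OF assms])
  \<comment> \<open>Swapping the coordinates moves this sum to the region \<open>x > y\<close> of
    the original double series.\<close>
  also have "?this \<longleftrightarrow> (?h has_sum ?S1) (prod.swap ` ?P)"
    by (subst has_sum_reindex) (auto simp: o_def case_prod_unfold mult.commute)
  finally have above: "(?h has_sum ?S1) (prod.swap ` ?P)" .

  \<comment> \<open>The same lemma with the pairs \<open>(a, m)\<close> and \<open>(b, n)\<close>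
    exchanged.\<close>
  have below: "(?h has_sum ?S2) ?P"
    unfolding f_def g_def using has_sum_below_diagonal[OF assms(2,1)] by (simp only: add.commute)

  have "((\<lambda>x. \<Sum>k=n..m+n. real (binom (int k) (int n)) * real (binom (int n) (int k - int m)) *
      (real ((x - 1) choose k) / real x ^ (a + b))) has_sum ?S3) {1..}"
    using assms by (intro has_sum_finite_sum has_sum_cmult_right lwc_mzv_has_sum_1) auto
  moreover have "(\<Sum>k=n..m+n. real (binom (int k) (int n)) * real (binom (int n) (int k - int m)) *
      (real ((x - 1) choose k) / real x ^ (a + b))) = f x * g x" for x
  proof -
    have "f x * g x = real (((x - 1) choose m) * ((x - 1) choose n)) / real x ^ (a + b)"
      by (simp add: f_def g_def power_add)
    thus ?thesis
      unfolding choose_product_diagonal by (simp add: sum_divide_distrib)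
  qed
  ultimately have "((\<lambda>x. f x * g x) has_sum ?S3) {1..}"
    by simp
  hence diag: "(?h has_sum ?S3) ((\<lambda>x. (x, x)) ` {1..})"
    by (subst has_sum_reindex) (auto simp: o_def inj_on_def)

  \<comment> \<open>The three disjoint regions fill the quadrant, so convergence of the double
    series is inherited from the pieces.\<close>
  have "(?h has_sum (?S1 + ?S2 + ?S3)) (prod.swap ` ?P \<union> ?P \<union> (\<lambda>x. (x, x)) ` {1..})"
    by (intro has_sum_Un_disjoint above below diag) auto
  also have "prod.swap ` ?P \<union> ?P \<union> (\<lambda>x. (x, x)) ` {1..} = {1..} \<times> {1..}"
    by (auto simp: image_iff)
  \<comment> \<open>Summing over \<open>y\<close> first gives \<open>f x * lwc_mzv [b] [n]\<close>.
    The sum over \<open>x\<close> is then known in two ways, and uniqueness of sums yields the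
    identity.\<close>
  finally have "((\<lambda>x. f x * lwc_mzv [b] [n]) has_sum (?S1 + ?S2 + ?S3)) {1..}"
    by (rule has_sum_SigmaD) (simp only: prod.case has_sum_cmult_right g)
  moreover have "((\<lambda>x. f x * lwc_mzv [b] [n]) has_sum (lwc_mzv [a] [m] * lwc_mzv [b] [n])) {1..}"
    by (intro has_sum_cmult_left f)
  ultimately show ?thesis
    by (rule has_sum_unique[symmetric])
qed

end
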